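(* Let $(P,\preceq)$ be a locally finite lattice and let $f:P\to\mathbb{C}$ be semimultiplicative with $f(x)\neq0$ for all $x\in P$. Let $S=\{x_1,\dots,x_n\}\subseteq P$ be join-closed, indexed so that $x_i\preceq x_j\Rightarrow i\le j$. If $(S)_f$ is invertible, then its inverse is the $n\times n$ matrix $B=(b_{ij})$ with $$b_{ij}=\frac{1}{f(x_i)f(x_j)}\sum_{x_k\in S,\ x_k\preceq x_i\wedge x_j}\frac{\mu_S(x_k,x_i)\mu_S(x_k,x_j)}{\Psi_{S,1/f}(x_k)},$$ where $\mu_S$ is the Möbius function of the poset $(S,\preceq)$.
   Context: $f$ is semimultiplicative if $f(x)f(y)=f(x\wedge y)f(x\vee y)$ for all $x,y\in P$. $S$ is join-closed if $x\vee y\in S$ for all $x,y\in S$. $(S)_f$ is the $n\times n$ matrix with $(i,j)$ entry $f(x_i\wedge x_j)$. $\Psi_{S,1/f}$ is defined on $S$ recursively by $\Psi_{S,1/f}(x_k)=1/f(x_k)-\sum_{x_v\in S,\ x_k\prec x_v}\Psi_{S,1/f}(x_v)$. *)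

theory Defs
  imports "Jordan_Normal_Form.Matrix"
begin

definition locally_finite :: "'a::order itself \<Rightarrow> bool" where
  "locally_finite _ \<longleftrightarrow> (\<forall>x y :: 'a. finite {x..y})"

definition semimultiplicative :: "('a::lattice \<Rightarrow> complex) \<Rightarrow> bool" where
  "semimultiplicative f \<longleftrightarrow> (\<forall>x y. f x * f y = f (inf x y) * f (sup x y))"

definition join_closed :: "'a::lattice set \<Rightarrow> bool" where
  "join_closed S \<longleftrightarrow> (\<forall>x\<in>S. \<forall>y\<in>S. sup x y \<in> S)"

text \<open>The matrix \<open>(S)\<^sub>f\<close> for \<open>S = {x 0, \<dots>, x (n - 1)}\<close>; matrix indices start at 0.\<close>

definition meet_matrix :: "nat \<Rightarrow> (nat \<Rightarrow> 'a::lattice) \<Rightarrow> ('a \<Rightarrow> complex) \<Rightarrow> complex mat" where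
  "meet_matrix n x f = mat n n (\<lambda>(i, j). f (inf (x i) (x j)))"

text \<open>The finiteness and membership guards only serve termination and fix junk values; see
  \<open>moebius_on_refl\<close>, \<open>moebius_on_less\<close> and \<open>Psi_eq\<close> for the intended recursions.\<close>

function moebius_on :: "'a::order set \<Rightarrow> 'a \<Rightarrow> 'a \<Rightarrow> int" where
  "moebius_on S x y =
     (if x \<in> S \<and> y \<in> S \<and> x \<le> y \<and> finite {z\<in>S. x \<le> z \<and> z \<le> y}
      then if x = y then 1
           else - (\<Sum>z\<in>{z\<in>S. x \<le> z \<and> z < y}. moebius_on S x z)
      else 0)"
  by auto
termination
proof (relation "measure (\<lambda>(S, x, y). card {z\<in>S. x \<le> z \<and> z \<le> y})", goal_cases)
  case (2 S x y z)
  have "{w\<in>S. x \<le> w \<and> w \<le> z} \<subset> {w\<in>S. x \<le> w \<and> w \<le> y}"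
    using 2 by (auto dest: order.strict_trans2 order.trans less_imp_le)
  then show ?case using 2 by (auto intro: psubset_card_mono)
qed auto

declare moebius_on.simps [simp del]

lemma moebius_on_refl: "x \<in> S \<Longrightarrow> moebius_on S x x = 1"
proof -
  assume "x \<in> S"
  moreover from this have "{z\<in>S. x \<le> z \<and> z \<le> x} = {x}" by auto
  ultimately show ?thesis by (simp add: moebius_on.simps[of S x x])
qed

lemma moebius_on_less:
  "finite S \<Longrightarrow> x \<in> S \<Longrightarrow> y \<in> S \<Longrightarrow> x < y \<Longrightarrow>
    moebius_on S x y = - (\<Sum>z\<in>{z\<in>S. x \<le> z \<and> z < y}. moebius_on S x z)"
  by (subst moebius_on.simps) auto

lemma moebius_on_not_le: "\<not> x \<le> y \<Longrightarrow> moebius_on S x y = 0"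
  by (simp add: moebius_on.simps[of S x y])

text \<open>\<open>Psi S g\<close> is the function \<open>\<Psi>\<^bsub>S,g\<^esub>\<close>.\<close>

function Psi :: "'a::order set \<Rightarrow> ('a \<Rightarrow> complex) \<Rightarrow> 'a \<Rightarrow> complex" where
  "Psi S g x = (if finite S then g x - (\<Sum>v\<in>{v\<in>S. x < v}. Psi S g v) else 0)"
  by auto
termination
proof (relation "measure (\<lambda>(S, g, x). card {v\<in>S. x < v})", goal_cases)
  case (2 S g x v)
  have "{w\<in>S. v < w} \<subset> {w\<in>S. x < w}"
    using 2 by (auto dest: order.strict_trans)
  then show ?case using 2 by (auto intro: psubset_card_mono)
qed auto

declare Psi.simps [simp del]

lemma Psi_eq: "finite S \<Longrightarrow> Psi S g x = g x - (\<Sum>v\<in>{v\<in>S. x < v}. Psi S g v)"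
  by (subst Psi.simps) simp

end

theory Submission imports Defs "Jordan_Normal_Form.Determinant" begin

text \<open>
  Semimultiplicativity gives \<open>f (inf x y) = f x * f y / f (sup x y)\<close>, and summing the recursion for
  \<open>\<Psi>\<close> gives \<open>1 / f w = (\<Sum>v \<ge> w. \<Psi> v)\<close> for \<open>w \<in> S\<close>. Since \<open>S\<close> is join-closed, the
  meet matrix therefore factors as \<open>W * D * W\<^sup>T\<close>, where \<open>D\<close> is the diagonal matrix of the values
  of \<open>\<Psi>\<close> and \<open>W\<close> is the zeta matrix of \<open>S\<close> with rows scaled by \<open>f\<close>. The inverse \<open>V\<close> of \<open>W\<close> is the
  Moebius matrix with columns scaled by \<open>1 / f\<close>, so the inverse is \<open>V\<^sup>T * D\<^sup>-\<^sup>1 * V\<close>.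
\<close>

text \<open>Terms with \<open>z\<close> not above \<open>x\<close> vanish, and on the interval from
  \<open>x\<close> to \<open>y\<close> the recursion for \<open>moebius_on\<close> cancels
  everything unless \<open>x = y\<close>. The sum runs over the second argument, which is what the
  entries of \<open>V * W\<close> need.\<close>

lemma sum_moebius_on:
  assumes "finite S" "x \<in> S" "y \<in> S"
  shows "(\<Sum>z\<in>{z\<in>S. z \<le> y}. moebius_on S x z) = (if x = y then 1 else 0)"
proof -
  have "(\<Sum>z\<in>{z\<in>S. z \<le> y}. moebius_on S x z) = (\<Sum>z\<in>{z\<in>S. x \<le> z \<and> z \<le> y}. moebius_on S x z)"
    using assms by (intro sum.mono_neutral_right) (auto intro: ccontr simp: moebius_on_not_le)
  also have "\<dots> = (if x = y then 1 else 0)"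
  proof (cases "x < y")
    case True
    then have "{z\<in>S. x \<le> z \<and> z \<le> y} = insert y {z\<in>S. x \<le> z \<and> z < y}"
      using assms by (auto simp: order_le_less)
    then show ?thesis
      using True assms by (simp add: moebius_on_less)
  next
    case False
    then have "{z\<in>S. x \<le> z \<and> z \<le> y} = (if x = y then {x} else {})"
      using assms by (auto simp: order_le_less)
    then show ?thesis
      using assms by (simp add: moebius_on_refl)
  qed
  finally show ?thesis .
qed

lemma sum_Psi:
  assumes "finite S" "x \<in> S"
  shows "(\<Sum>v\<in>{v\<in>S. x \<le> v}. Psi S g v) = g x"
proof -
  have "{v\<in>S. x \<le> v} = insert x {v\<in>S. x < v}"
    using assms by (auto simp: order_le_less)
  then show ?thesis
    using assms by (simp add: Psi_eq[of S g x])
qed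

text \<open>The common upper bounds of \<open>x\<close> and \<open>y\<close> in \<open>S\<close> are
  the elements of \<open>S\<close> above \<open>sup x y\<close>. As \<open>S\<close> contains this
  join, their \<open>Psi\<close> values add up to \<open>1 / f (sup x y)\<close>.\<close>

lemma semimultiplicative_inf_eq:
  assumes "finite S" "join_closed S" "semimultiplicative f" "\<And>y. f y \<noteq> 0" "x \<in> S" "y \<in> S"
  shows "f (inf x y) = f x * f y * (\<Sum>v\<in>{v\<in>S. x \<le> v \<and> y \<le> v}. Psi S (\<lambda>z. 1 / f z) v)"
proof -
  have "f x * f y = f (inf x y) * f (sup x y)" "sup x y \<in> S"
    using assms by (auto simp: semimultiplicative_def join_closed_def)
  moreover from this have "(\<Sum>v\<in>{v\<in>S. x \<le> v \<and> y \<le> v}. Psi S (\<lambda>z. 1 / f z) v) = 1 / f (sup x y)"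
    using sum_Psi[of S "sup x y" "\<lambda>z. 1 / f z"] assms by simp
  ultimately show ?thesis
    using assms(4) by simp
qed

lemma sum_bij_betw_if:
  fixes x :: "nat \<Rightarrow> 'a"
  assumes "bij_betw x {0..<n} S"
  shows "(\<Sum>k\<in>{0..<n}. if P (x k) then h (x k) else 0) = (\<Sum>v\<in>{v\<in>S. P v}. h v)"
proof -
  have "finite S"
    using bij_betw_finite[OF assms] by simp
  show ?thesis
    unfolding sum.inter_filter[OF \<open>finite S\<close>] by (intro sum.reindex_bij_betw[OF assms])
qed

lemma index_mult_diag_mult:
  assumes "A \<in> carrier_mat m n" "B \<in> carrier_mat n k" "i < m" "j < k"
  shows "(A * mat_diag n d * B) $$ (i, j) = (\<Sum>l\<in>{0..<n}. A $$ (i, l) * d l * B $$ (l, j))"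
  unfolding mat_diag_mult_right[OF assms(1)] using assms by (simp add: scalar_prod_def)

text \<open>Cancelling the outer factor \<open>W\<close> shows that the diagonal matrix has a right
  inverse, so none of its rows can vanish.\<close>

lemma diag_nonzero_of_congruence_invertible:
  fixes d :: "nat \<Rightarrow> 'a::field"
  assumes V: "V \<in> carrier_mat n n" and W: "W \<in> carrier_mat n n" and VW: "V * W = 1\<^sub>m n"
    and inv: "invertible_mat (W * mat_diag n d * transpose_mat W)" and k: "k < n"
  shows "d k \<noteq> 0"
proof
  assume 0: "d k = 0"
  let ?D = "mat_diag n d"
  let ?A = "W * ?D * transpose_mat W"
  have D: "?D \<in> carrier_mat n n" by simp
  have WT: "transpose_mat W \<in> carrier_mat n n" using W by simp
  have A: "?A \<in> carrier_mat n n" by (intro mult_carrier_mat[of _ n n] W D WT)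
  obtain C where AC: "?A * C = 1\<^sub>m n" and CA: "C * ?A = 1\<^sub>m (dim_row C)"
    using inv carrier_matD(1)[OF A] unfolding invertible_mat_def inverts_mat_def by metis
  \<comment> \<open>\<open>invertible_mat\<close> does not fix the size of \<open>C\<close>: its
    column count comes from \<open>AC\<close>, its row count from \<open>CA\<close>.\<close>
  have C: "C \<in> carrier_mat n n"
    using arg_cong[OF AC, of dim_col] arg_cong[OF CA, of dim_col] W by (intro carrier_matI) simp_all
  define M where "M = transpose_mat W * C * W"
  have M: "M \<in> carrier_mat n n"
    unfolding M_def by (intro mult_carrier_mat[of _ n n] C W WT)
  \<comment> \<open>Inserting \<open>V * W\<close> on the left completes
    \<open>?D * transpose_mat W\<close> to \<open>?A\<close>, which then meets
    \<open>C\<close>.\<close>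
  have "?D * M = (V * W) * ?D * M"
    by (simp only: VW left_mult_one_mat[OF D])
  also have "\<dots> = V * (?A * C) * W"
    using V W C D by (simp add: M_def assoc_mult_mat[of _ n n _ n _ n] mult_carrier_mat[of _ n n _ n])
  also have "\<dots> = 1\<^sub>m n"
    by (simp only: AC VW right_mult_one_mat[OF V])
  finally have "(?D * M) $$ (k, k) = 1" using k by simp
  then show False using 0 M k by (simp add: mat_diag_mult_left)
qed

text \<open>The product collapses from the inside out: first the transposes, then the two diagonal
  matrices, and finally \<open>W * V\<close>.\<close>

lemma congruence_mult_inverse:
  fixes d :: "nat \<Rightarrow> 'a::field"
  assumes V: "V \<in> carrier_mat n n" and W: "W \<in> carrier_mat n n" and VW: "V * W = 1\<^sub>m n"
    and d: "\<And>k. k < n \<Longrightarrow> d k \<noteq> 0"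
  shows "(W * mat_diag n d * transpose_mat W) *
    (transpose_mat V * mat_diag n (\<lambda>k. inverse (d k)) * V) = 1\<^sub>m n"
proof -
  let ?D = "mat_diag n d" and ?E = "mat_diag n (\<lambda>k. inverse (d k))"
  have D: "?D \<in> carrier_mat n n" and E: "?E \<in> carrier_mat n n" by simp_all
  have WV: "W * V = 1\<^sub>m n"
    using mat_mult_left_right_inverse[OF V W VW] .
  have tr: "transpose_mat W * transpose_mat V = 1\<^sub>m n"
    using transpose_mult[OF V W] VW by simp
  have DE: "?D * ?E = 1\<^sub>m n"
    using d unfolding mat_diag_diag by (intro eq_matI) (auto simp: mat_diag_def)
  have "(W * ?D * transpose_mat W) * (transpose_mat V * ?E * V)
      = W * (?D * ((transpose_mat W * transpose_mat V) * ?E)) * V"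
    using V W D E by (simp add: assoc_mult_mat[of _ n n _ n _ n] mult_carrier_mat[of _ n n _ n])
  also have "\<dots> = 1\<^sub>m n"
    by (simp only: tr DE WV left_mult_one_mat[OF E] right_mult_one_mat[OF W])
  finally show ?thesis .
qed

theorem theorem6p11:
  fixes f :: "'a::lattice \<Rightarrow> complex" and x :: "nat \<Rightarrow> 'a" and n :: nat and S :: "'a set"
  assumes "locally_finite TYPE('a)"
    and "semimultiplicative f"
    and "\<And>y. f y \<noteq> 0"
    and "bij_betw x {0..<n} S"
    and "\<And>i j. i < n \<Longrightarrow> j < n \<Longrightarrow> x i \<le> x j \<Longrightarrow> i \<le> j"
    and "join_closed S"
    and "invertible_mat (meet_matrix n x f)"
  defines "B \<equiv> mat n n (\<lambda>(i, j). 1 / (f (x i) * f (x j)) *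
      (\<Sum>y\<in>{y\<in>S. y \<le> inf (x i) (x j)}.
         of_int (moebius_on S y (x i)) * of_int (moebius_on S y (x j))
         / Psi S (\<lambda>z. 1 / f z) y))"
  shows "inverts_mat (meet_matrix n x f) B \<and> inverts_mat B (meet_matrix n x f)"
proof -
  let ?\<Psi> = "Psi S (\<lambda>z. 1 / f z)"
  define W where "W = mat n n (\<lambda>(i, k). if x i \<le> x k then f (x i) else 0)"
  define V where "V = mat n n (\<lambda>(k, j). of_int (moebius_on S (x k) (x j)) / f (x j))"
  define d where "d k = ?\<Psi> (x k)" for k
  have V: "V \<in> carrier_mat n n" and W: "W \<in> carrier_mat n n"
    by (simp_all add: V_def W_def)
  have fin: "finite S"
    using bij_betw_finite[OF assms(4)] by simp
  have xS: "x i \<in> S" if "i < n" for i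
    using assms(4) that by (auto simp: bij_betw_def)
  have x_eq: "x i = x j \<longleftrightarrow> i = j" if "i < n" "j < n" for i j
    using assms(4) that by (auto simp: bij_betw_def inj_on_def)
  have VW: "V * W = 1\<^sub>m n"
  proof (rule eq_matI)
    fix i j assume "i < dim_row (1\<^sub>m n :: complex mat)" "j < dim_col (1\<^sub>m n :: complex mat)"
    then have ij: "i < n" "j < n" by simp_all
    \<comment> \<open>The column scaling \<open>1 / f (x k)\<close> of \<open>V\<close> cancels the
      row scaling \<open>f (x k)\<close> of \<open>W\<close>.\<close>
    have "(V * W) $$ (i, j)
        = (\<Sum>k\<in>{0..<n}. if x k \<le> x j then of_int (moebius_on S (x i) (x k)) else 0)"
      using ij assms(3) by (auto simp: V_def W_def scalar_prod_def intro!: sum.cong)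
    also have "\<dots> = of_int (\<Sum>z\<in>{z\<in>S. z \<le> x j}. moebius_on S (x i) z)"
      using sum_bij_betw_if[OF assms(4), of "\<lambda>z. z \<le> x j" "\<lambda>z. of_int (moebius_on S (x i) z)"]
      by simp
    also have "\<dots> = 1\<^sub>m n $$ (i, j)"
      using ij by (simp add: sum_moebius_on fin xS x_eq)
    finally show "(V * W) $$ (i, j) = 1\<^sub>m n $$ (i, j)" .
  qed (simp_all add: V_def W_def)
  have A: "meet_matrix n x f = W * mat_diag n d * transpose_mat W"
  proof (rule eq_matI)
    fix i j assume "i < dim_row (W * mat_diag n d * transpose_mat W)"
      "j < dim_col (W * mat_diag n d * transpose_mat W)"
    then have ij: "i < n" "j < n" by (simp_all add: W_def)
    have "(W * mat_diag n d * transpose_mat W) $$ (i, j)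
        = (\<Sum>k\<in>{0..<n}. if x i \<le> x k \<and> x j \<le> x k then f (x i) * f (x j) * ?\<Psi> (x k) else 0)"
      using ij W
      by (subst index_mult_diag_mult[of _ n n _ n]) (auto simp: W_def d_def intro!: sum.cong)
    also have "\<dots> = (\<Sum>v\<in>{v\<in>S. x i \<le> v \<and> x j \<le> v}. f (x i) * f (x j) * ?\<Psi> v)"
      by (rule sum_bij_betw_if[OF assms(4)])
    also have "\<dots> = f (inf (x i) (x j))"
      unfolding sum_distrib_left[symmetric]
      using ij by (intro semimultiplicative_inf_eq[symmetric] fin xS assms(2,3,6))
    finally show "meet_matrix n x f $$ (i, j) = (W * mat_diag n d * transpose_mat W) $$ (i, j)"
      using ij by (simp add: meet_matrix_def)
  qed (simp_all add: meet_matrix_def W_def)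
  have B: "B = transpose_mat V * mat_diag n (\<lambda>k. inverse (d k)) * V"
  proof (rule eq_matI)
    fix i j assume "i < dim_row (transpose_mat V * mat_diag n (\<lambda>k. inverse (d k)) * V)"
      "j < dim_col (transpose_mat V * mat_diag n (\<lambda>k. inverse (d k)) * V)"
    then have ij: "i < n" "j < n" by (simp_all add: V_def)
    let ?h = "\<lambda>y. 1 / (f (x i) * f (x j)) *
      (of_int (moebius_on S y (x i)) * of_int (moebius_on S y (x j)) / ?\<Psi> y)"
    \<comment> \<open>The matrix product sums over all indices; unless \<open>x k\<close> lies below
      both \<open>x i\<close> and \<open>x j\<close>, one Moebius factor is zero.\<close>
    have "(transpose_mat V * mat_diag n (\<lambda>k. inverse (d k)) * V) $$ (i, j)
        = (\<Sum>k\<in>{0..<n}. if x k \<le> inf (x i) (x j) then ?h (x k) else 0)"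
      using ij V
      by (subst index_mult_diag_mult[of _ n n _ n])
        (auto simp: V_def d_def moebius_on_not_le field_simps intro!: sum.cong)
    also have "\<dots> = (\<Sum>y\<in>{y\<in>S. y \<le> inf (x i) (x j)}. ?h y)"
      by (rule sum_bij_betw_if[OF assms(4)])
    finally show "B $$ (i, j) = (transpose_mat V * mat_diag n (\<lambda>k. inverse (d k)) * V) $$ (i, j)"
      using ij by (simp add: B_def sum_distrib_left)
  qed (simp_all add: B_def V_def)
  \<comment> \<open>This is where invertibility of the meet matrix enters: it ensures that the
    formula for \<open>B\<close> never divides by zero.\<close>
  have d: "d k \<noteq> 0" if "k < n" for k
    using diag_nonzero_of_congruence_invertible[OF V W VW _ that] assms(7) A by simp
  have AB: "meet_matrix n x f * B = 1\<^sub>m n"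
    using congruence_mult_inverse[OF V W VW d] A B by simp
  \<comment> \<open>For square matrices a right inverse is also a left inverse.\<close>
  moreover have "B * meet_matrix n x f = 1\<^sub>m n"
    by (rule mat_mult_left_right_inverse[OF _ _ AB]) (simp_all add: meet_matrix_def B_def)
  ultimately show ?thesis
    by (simp add: inverts_mat_def meet_matrix_def B_def)
qed

end
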